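(* Let $H:=(\pm 6;1)=\{\dots,-17,-11,-5,1,7,13,19,\dots\}$. Then $H$ is, in $\mathbb Z$, the smallest arithmetic sequence that is a superset of $P\setminus\{3,2\}$, where $P$ is the set of primes.
   Context: $(\pm d;a):=\{a+kd:k\in\mathbb Z\}$ denotes the two-sided arithmetic sequence of integers with initial term $a$ and constant difference $d$. Primes are allowed to be negative, so a prime $p$ counts as contained in a sequence if $p$ or $-p$ is a term of it. A sequence counts as smaller the larger its difference $d$ is. The sequences compared are those of the form $(\pm d;a)$ in which multiplication is kept as an operation, for which the initial term is taken to be $a=1$; $(\pm d;1)$ is identified with $-(\pm d;d-1)$, its mirror image under $x\mapsto -x$. *)

theory Defs
  imports "HOL-Computational_Algebra.Primes"
begin

definition arith_seq :: "int \<Rightarrow> int \<Rightarrow> int set"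
  where "arith_seq d a = {a + k * d | k. True}"

lemma arith_seq_1_mirror: "arith_seq d 1 = uminus ` arith_seq d (d - 1)"
proof (intro subset_antisym subsetI)
  fix x assume "x \<in> arith_seq d 1"
  then obtain k where "x = 1 + k * d" by (auto simp: arith_seq_def)
  then have "x = - ((d - 1) + (- k - 1) * d)" by (simp add: algebra_simps)
  then show "x \<in> uminus ` arith_seq d (d - 1)" unfolding arith_seq_def by blast
next
  fix x assume "x \<in> uminus ` arith_seq d (d - 1)"
  then obtain k where "x = - ((d - 1) + k * d)" unfolding arith_seq_def by blast
  then have "x = 1 + (- k - 1) * d" by (simp add: algebra_simps)
  then show "x \<in> arith_seq d 1" unfolding arith_seq_def by blast
qed

definition mult_closed :: "int set \<Rightarrow> bool"
  where "mult_closed S \<longleftrightarrow> (\<forall>x\<in>S. \<forall>y\<in>S. x * y \<in> S)"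

text \<open>
  The arithmetic sequences that are compared: those closed under multiplication,
  normalised to have initial term \<open>1\<close>. By the mirror lemma above this class also
  consists of the sets \<open>- (\<plusminus> d; d - 1)\<close>.
\<close>

definition mult_arith_seqs :: "int set set"
  where "mult_arith_seqs = {S. mult_closed S \<and> (\<exists>d>0. S = arith_seq d 1)}"

text \<open>
  Primes may be negative: a prime counts as contained in a sequence as soon as it
  or its negative is a term.
\<close>

definition superset_up_to_sign :: "int set \<Rightarrow> int set \<Rightarrow> bool"
  where "superset_up_to_sign S A \<longleftrightarrow> (\<forall>p\<in>A. p \<in> S \<or> - p \<in> S)"

text \<open>
  Size is measured by the difference, not by inclusion: the larger the (positive)
  difference, the smaller the sequence. The positive difference of a two-sided
  sequence is determined by the set, so this is a strict order.
\<close>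

definition smaller_seq :: "int set \<Rightarrow> int set \<Rightarrow> bool"
  where "smaller_seq S T \<longleftrightarrow>
    (\<exists>d a e b. 0 < d \<and> 0 < e \<and> S = arith_seq d a \<and> T = arith_seq e b \<and> d > e)"

definition smallest_seq_in :: "int set set \<Rightarrow> int set \<Rightarrow> bool"
  where "smallest_seq_in C S \<longleftrightarrow> S \<in> C \<and> (\<forall>T\<in>C. T \<noteq> S \<longrightarrow> smaller_seq S T)"

end

theory Submission imports Defs begin

text \<open>The sequence with initial term 1 and difference \<open>d\<close> is the residue class of
  1 modulo \<open>d\<close>. A prime other than 2 and 3 is coprime to 6, hence congruent to 1 or -1
  modulo 6, so it lies in \<open>H\<close> up to sign
  (\<open>superset_up_to_sign_arith_seq_6\<close>). Conversely, the single prime 5 already rules out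
  every difference above 6 (\<open>superset_up_to_sign_difference_le_6\<close>), so any competitor
  other than \<open>H\<close> has a difference below 6.\<close>

lemma mem_arith_seq_iff: "x \<in> arith_seq d a \<longleftrightarrow> d dvd x - a"
proof
  assume "x \<in> arith_seq d a"
  then show "d dvd x - a" by (auto simp: arith_seq_def)
next
  assume "d dvd x - a"
  then obtain k where "x - a = d * k" ..
  then have "x = a + k * d" by (simp add: algebra_simps)
  then show "x \<in> arith_seq d a" by (auto simp: arith_seq_def)
qed

text \<open>The residue 1 is idempotent modulo any \<open>d\<close>; explicitly, x y - 1 = (x - 1) y
  + (y - 1).\<close>

lemma mult_closed_arith_seq_1: "mult_closed (arith_seq d 1)"
  unfolding mult_closed_def mem_arith_seq_iff
proof (intro ballI, unfold mem_arith_seq_iff)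
  fix x y :: int
  assume "d dvd x - 1" "d dvd y - 1"
  then have "d dvd (x - 1) * y + (y - 1)" by simp
  then show "d dvd x * y - 1" by (simp add: algebra_simps)
qed

lemma prime_int_mod_6:
  fixes p :: int
  assumes "prime p" "p \<noteq> 2" "p \<noteq> 3"
  shows "p mod 6 = 1 \<or> p mod 6 = 5"
proof -
  \<comment> \<open>A prime divisible by the prime 2 or 3 would equal it. This excludes the residues
    0, 2, 3, 4.\<close>
  have "\<not> 2 dvd p" "\<not> 3 dvd p"
    using assms primes_dvd_imp_eq[of 2 p] primes_dvd_imp_eq[of 3 p] by auto
  then show ?thesis by presburger
qed

lemma superset_up_to_sign_arith_seq_6:
  "superset_up_to_sign (arith_seq 6 1) ({p. prime p} - {3, 2})"
  unfolding superset_up_to_sign_def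
proof
  fix p :: int
  assume "p \<in> {p. prime p} - {3, 2}"
  then have "p mod 6 = 1 \<or> p mod 6 = 5" by (intro prime_int_mod_6) auto
  \<comment> \<open>The freedom of sign serves the residue 5: there \<open>- p\<close> is congruent
    to 1.\<close>
  then show "p \<in> arith_seq 6 1 \<or> - p \<in> arith_seq 6 1"
    unfolding mem_arith_seq_iff by presburger
qed

text \<open>The prime 5 alone bounds the difference: it forces \<open>d dvd 4\<close> or \<open>d dvd 6\<close>.\<close>

lemma superset_up_to_sign_difference_le_6:
  assumes "superset_up_to_sign (arith_seq d 1) ({p. prime p} - {3, 2})"
  shows "d \<le> 6"
proof -
  have "prime (5::int)" by simp
  then have "(5::int) \<in> {p. prime p} - {3, 2}" by simp
  then have "5 \<in> arith_seq d 1 \<or> - 5 \<in> arith_seq d 1"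
    using assms unfolding superset_up_to_sign_def by blast
  \<comment> \<open>The differences to the initial term are 5 - 1 = 4 and -5 - 1 = -6.\<close>
  then have "d dvd 4 \<or> d dvd 6" by (simp add: mem_arith_seq_iff)
  then show ?thesis using zdvd_imp_le[of d 4] zdvd_imp_le[of d 6] by auto
qed

theorem mainTheorem1:
  fixes H P :: "int set"
  assumes "H = arith_seq 6 1"
    and "P = {p. prime p}"
  shows "smallest_seq_in {S \<in> mult_arith_seqs. superset_up_to_sign S (P - {3, 2})} H"
  unfolding smallest_seq_in_def
proof (intro conjI ballI impI)
  have "H \<in> mult_arith_seqs"
    using mult_closed_arith_seq_1[of 6] unfolding mult_arith_seqs_def assms(1)
    by (auto intro: exI[of _ 6])
  then show "H \<in> {S \<in> mult_arith_seqs. superset_up_to_sign S (P - {3, 2})}"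
    using superset_up_to_sign_arith_seq_6 by (simp add: assms)
next
  fix T
  assume T: "T \<in> {S \<in> mult_arith_seqs. superset_up_to_sign S (P - {3, 2})}" and "T \<noteq> H"
  then obtain d where d: "0 < d" "T = arith_seq d 1"
    unfolding mult_arith_seqs_def by blast
  have "d \<le> 6"
    using T superset_up_to_sign_difference_le_6 by (simp add: assms d(2))
  \<comment> \<open>Both sequences have initial term 1, so equal differences would make them equal;
    hence the order is strict.\<close>
  moreover have "d \<noteq> 6" using \<open>T \<noteq> H\<close> d(2) assms(1) by auto
  ultimately have "d < 6" by simp
  with d show "smaller_seq H T"
    unfolding smaller_seq_def assms(1)
    by (intro exI[of _ 6] exI[of _ 1] exI[of _ d]) simp
qed

end
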